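(* For every integer $m\ge 0$ and every integer $k\ge 1$, one has, as polynomials in $x$ (i.e. for all $x\in\mathbb{C}_p$), \[ B_m^{(k)}(-x)=\sum_{n=0}^{m}\widehat{D}_n^{(k)}(x)\,(-1)^{m-n}S_2(m,n). \]
   Context: Fix a prime $p$. $\mathbb{Z}_p$ is the ring of $p$-adic integers and $\mathbb{C}_p$ is the completion of an algebraic closure of $\mathbb{Q}_p$. For a uniformly differentiable function $f$ on $\mathbb{Z}_p$ (with values in $\mathbb{C}_p$), the $p$-adic invariant (Volkenborn) integral is $\int_{\mathbb{Z}_p}f(x)\,d\mu(x)=\lim_{N\to\infty}\frac{1}{p^N}\sum_{x=0}^{p^N-1}f(x)$. Write $y^{(n)}=y(y+1)\cdots(y+n-1)$ for the rising factorial (with $y^{(0)}=1$). The Daehee polynomials of the second kind of order $k$ are defined by the $k$-fold iterated integral \[ \widehat{D}_n^{(k)}(x)=\int_{\mathbb{Z}_p}\cdots\int_{\mathbb{Z}_p}(x_1+\cdots+x_k-x)^{(n)}\,d\mu(x_1)\cdots d\mu(x_k). \] The Bernoulli polynomials of order $\alpha\in\mathbb{N}$ are defined by $\left(\frac{t}{e^t-1}\right)^{\alpha}e^{xt}=\sum_{n\ge0}B_n^{(\alpha)}(x)\frac{t^n}{n!}$. The Stirling numbers of the second kind $S_2(l,n)$ are defined by $(e^t-1)^n=n!\sum_{l\ge n}S_2(l,n)\frac{t^l}{l!}$. *)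

theory Defs
  imports
    "HOL-Analysis.Analysis"
    "HOL-Computational_Algebra.Computational_Algebra"
    "HOL-Combinatorics.Stirling"
begin

section \<open>The field of \<open>p\<close>-adic complex numbers\<close>

text \<open>
  No construction of the \<open>p\<close>-adic complex numbers is at hand, so they are described by their defining
  property, which determines them up to isometric isomorphism: a complete field whose absolute value
  restricts to the \<open>p\<close>-adic one on the rationals, and in which the elements algebraic over \<open>\<rat>\<^sub>p\<close>
  form a dense, algebraically closed subfield. Inside a complete field, \<open>\<rat>\<^sub>p\<close> (the completion of the
  rationals) is the closure of the rationals.

  The metric is the one of the type class; the absolute value is the distance to zero. The class
  \<open>real_normed_field\<close> cannot be used, since its real scalar multiplication is incompatible with an
  ultrametric norm (and the library restricts the constant \<open>norm\<close> to real normed spaces).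
\<close>

definition pabs :: "'a::{field_char_0, complete_space} \<Rightarrow> real" where
  "pabs x = dist x 0"

definition Qp :: "'a::{field_char_0, complete_space} set" where
  "Qp = closure \<rat>"

definition Zp :: "'a::{field_char_0, complete_space} set" where
  "Zp = {x \<in> Qp. pabs x \<le> 1}"

definition algebraic_over :: "'a::field set \<Rightarrow> 'a \<Rightarrow> bool" where
  "algebraic_over F a \<longleftrightarrow> (\<exists>P. P \<noteq> 0 \<and> (\<forall>i. coeff P i \<in> F) \<and> poly P a = 0)"

definition Qp_alg :: "'a::{field_char_0, complete_space} set" where
  "Qp_alg = {a. algebraic_over Qp a}"

text \<open>
  A multiplicative ultrametric absolute value with \<open>\<bar>p\<bar> = 1/p\<close> necessarily restricts to the \<open>p\<close>-adic
  absolute value on the rationals.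
\<close>

definition padic_complex_field ::
    "'a::{field_char_0, complete_space} itself \<Rightarrow> nat \<Rightarrow> bool" where
  "padic_complex_field _ p \<longleftrightarrow>
     prime p \<and>
     (\<forall>x y :: 'a. dist x y = pabs (x - y)) \<and>
     (\<forall>x y :: 'a. pabs (x * y) = pabs x * pabs y) \<and>
     (\<forall>x y :: 'a. pabs (x + y) \<le> max (pabs x) (pabs y)) \<and>
     pabs (of_nat p :: 'a) = 1 / real p \<and>
     (\<forall>P :: 'a poly. degree P > 0 \<and> (\<forall>i. coeff P i \<in> Qp_alg) \<longrightarrow> (\<exists>z\<in>Qp_alg. poly P z = 0)) \<and>
     closure (Qp_alg :: 'a set) = UNIV"


section \<open>The Volkenborn integral\<close>

text \<open>
  Functions on \<open>Zp\<close> are represented by total functions, of which only the values on \<open>Zp\<close> are used.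
\<close>

definition uniformly_differentiable_on_Zp ::
    "('a::{field_char_0, complete_space} \<Rightarrow> 'a) \<Rightarrow> bool" where
  "uniformly_differentiable_on_Zp f \<longleftrightarrow>
     (\<exists>f'. \<forall>e>0. \<exists>d>0. \<forall>x\<in>Zp. \<forall>y\<in>Zp. x \<noteq> y \<and> dist x y < d \<longrightarrow>
        dist ((f x - f y) / (x - y)) (f' x) < e)"

definition has_volkenborn_integral ::
    "nat \<Rightarrow> ('a::{field_char_0, complete_space} \<Rightarrow> 'a) \<Rightarrow> 'a \<Rightarrow> bool" where
  "has_volkenborn_integral p f I \<longleftrightarrow>
     uniformly_differentiable_on_Zp f \<and>
     (\<lambda>N. 1 / of_nat (p ^ N) * (\<Sum>x<p ^ N. f (of_nat x))) \<longlonglongrightarrow> I"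

definition volkenborn :: "nat \<Rightarrow> ('a::{field_char_0, complete_space} \<Rightarrow> 'a) \<Rightarrow> 'a" where
  "volkenborn p f = (THE I. has_volkenborn_integral p f I)"

text \<open>
  The list argument of the integrand is \<open>[x\<^sub>1, \<dots>, x\<^sub>k]\<close>; the integral over \<open>x\<^sub>1\<close> is the innermost one.
\<close>

primrec volkenborn_iter ::
    "nat \<Rightarrow> nat \<Rightarrow> ('a::{field_char_0, complete_space} list \<Rightarrow> 'a) \<Rightarrow> 'a" where
  "volkenborn_iter p 0 F = F []"
| "volkenborn_iter p (Suc k) F = volkenborn p (\<lambda>t. volkenborn_iter p k (\<lambda>xs. F (xs @ [t])))"


section \<open>Daehee and Bernoulli polynomials\<close>

definition Daehee2 :: "nat \<Rightarrow> nat \<Rightarrow> nat \<Rightarrow> 'a::{field_char_0, complete_space} \<Rightarrow> 'a" where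
  "Daehee2 p k n x = volkenborn_iter p k (\<lambda>xs. pochhammer (sum_list xs - x) n)"

definition bernpoly_order :: "nat \<Rightarrow> nat \<Rightarrow> 'a::field_char_0 \<Rightarrow> 'a" where
  "bernpoly_order \<alpha> n x = fact n * fps_nth ((fps_X / (fps_exp 1 - 1)) ^ \<alpha> * fps_exp x) n"

text \<open>
  The quotient in the previous definition is a genuine one, and the library's Stirling numbers of the
  second kind have the exponential generating function \<open>(e\<^sup>t - 1)\<^sup>n / n!\<close>.
\<close>

lemma bernoulli_fps_quotient:
  "(fps_X / (fps_exp 1 - 1)) * (fps_exp 1 - 1) = (fps_X :: 'a::field_char_0 fps)"
proof -
  have nz: "fps_exp 1 - 1 \<noteq> (0 :: 'a fps)"
    by (auto simp: fps_eq_iff intro!: exI[of _ 1])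
  have "subdegree (fps_exp 1 - 1 :: 'a fps) = 1"
    by (rule subdegreeI) auto
  then have "fps_exp 1 - 1 dvd (fps_X :: 'a fps)"
    using nz by (subst fps_dvd_iff) auto
  then show ?thesis
    by simp
qed

lemma Stirling_fps:
  "(fps_exp 1 - 1) ^ n =
     fps_const (fact n) * Abs_fps (\<lambda>l. of_nat (Stirling l n) / fact l :: 'a::field_char_0)"
proof -
  let ?E = "fps_exp 1 - 1 :: 'a fps"
  have "fact l * fps_nth (?E ^ n) l = fact n * of_nat (Stirling l n)" for l
  proof (induction l arbitrary: n)
    case 0
    then show ?case by (cases n) (auto simp: fps_nth_power_0)
  next
    case (Suc l)
    show ?case
    proof (cases n)
      case 0
      then show ?thesis by simp
    next
      case (Suc k)
      have "fps_deriv (?E ^ Suc k) = fps_const (of_nat (Suc k)) * (?E ^ Suc k + ?E ^ k)"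
        by (subst fps_deriv_power) (simp add: algebra_simps)
      then have *: "of_nat (Suc l) * fps_nth (?E ^ Suc k) (Suc l) =
          of_nat (Suc k) * (fps_nth (?E ^ Suc k) l + fps_nth (?E ^ k) l)"
        by (metis Suc_eq_plus1 fps_deriv_nth fps_mult_left_const_nth fps_add_nth)
      have "fact (Suc l) * fps_nth (?E ^ Suc k) (Suc l) =
          fact l * (of_nat (Suc l) * fps_nth (?E ^ Suc k) (Suc l))"
        by (simp only: fact_Suc of_nat_mult mult_ac)
      then have "fact (Suc l) * fps_nth (?E ^ Suc k) (Suc l) =
          of_nat (Suc k) * (fact l * fps_nth (?E ^ Suc k) l + fact l * fps_nth (?E ^ k) l)"
        unfolding * by (simp only: distrib_left mult_ac)
      also have "\<dots> = fact (Suc k) * of_nat (Stirling (Suc l) (Suc k))"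
        unfolding Suc.IH by (simp add: algebra_simps)
      finally show ?thesis using Suc by simp
    qed
  qed
  then show ?thesis
    by (auto simp: fps_eq_iff field_simps)
qed

end

theory Submission
  imports Defs
begin

text \<open>
  If \<open>Q(t + 1) - Q(t) = P(t)\<close> for polynomials \<open>P\<close> and \<open>Q\<close>, then the sums defining the Volkenborn
  integral of \<open>P\<close> telescope to the difference quotients \<open>(Q(p\<^sup>N) - Q(0)) / p\<^sup>N\<close>, and \<open>p\<^sup>N\<close> tends to 0,
  so the integral is \<open>Q'(0)\<close>. The generating function gives
  \<open>B\<^bsub>n+1\<^esub>\<^bsup>(k+1)\<^esup>(t + 1) - B\<^bsub>n+1\<^esub>\<^bsup>(k+1)\<^esup>(t) = (n + 1) B\<^sub>n\<^bsup>(k)\<^esup>(t)\<close>, hence one integration raises the order of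
  a Bernoulli polynomial by one, and the \<open>k\<close>-fold integral of \<open>(x\<^sub>1 + \<dots> + x\<^sub>k - x)\<^sup>m\<close> is \<open>B\<^sub>m\<^bsup>(k)\<^esup>(-x)\<close>.
  It remains to expand the power in rising factorials.
\<close>

section \<open>Powers in terms of rising factorials\<close>

text \<open>Induction on \<open>m\<close>: multiplication by \<open>y\<close> sends
  \<open>pochhammer y n\<close> to \<open>pochhammer y (Suc n) - of_nat n * pochhammer y n\<close>,
  which matches the recurrence of the Stirling numbers up to sign.\<close>

lemma power_eq_sum_Stirling_pochhammer:
  fixes y :: "'a::comm_ring_1"
  shows "y ^ m = (\<Sum>n\<le>m. (-1) ^ (m - n) * of_nat (Stirling m n) * pochhammer y n)"
proof (induction m)
  case 0
  then show ?case by simp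
next
  case (Suc m)
  define s :: "nat \<Rightarrow> 'a" where "s n = (-1) ^ (m - n) * of_nat (Stirling m n)" for n
  define g :: "nat \<Rightarrow> 'a" where
    "g n = (-1) ^ (Suc m - n) * of_nat n * of_nat (Stirling m n) * pochhammer y n" for n
  have y_mult: "y * pochhammer y n = pochhammer y (Suc n) - of_nat n * pochhammer y n" for n
    by (simp add: pochhammer_Suc algebra_simps)
  have "y ^ Suc m = (\<Sum>n\<le>m. s n * (y * pochhammer y n))"
    unfolding power_Suc Suc.IH sum_distrib_left by (rule sum.cong) (simp_all add: s_def mult_ac)
  also have "\<dots> = (\<Sum>n\<le>m. s n * pochhammer y (Suc n) + g n)"
    by (rule sum.cong) (simp_all add: y_mult s_def g_def Suc_diff_le algebra_simps)
  \<comment> \<open>The range of \<open>g\<close> extends to \<open>Suc m\<close> because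
    \<open>Stirling m (Suc m) = 0\<close>; the index can then be shifted because
    \<open>g 0 = 0\<close>.\<close>
  also have "\<dots> = (\<Sum>n\<le>m. s n * pochhammer y (Suc n)) + (\<Sum>n\<le>Suc m. g n)"
    by (simp add: sum.distrib g_def)
  also have "(\<Sum>n\<le>Suc m. g n) = (\<Sum>n\<le>m. g (Suc n))"
    by (subst sum.atMost_Suc_shift) (simp add: g_def)
  also have "(\<Sum>n\<le>m. s n * pochhammer y (Suc n)) + (\<Sum>n\<le>m. g (Suc n)) =
      (\<Sum>n\<le>m. (-1) ^ (m - n) * of_nat (Stirling (Suc m) (Suc n)) * pochhammer y (Suc n))"
    unfolding sum.distrib [symmetric]
    by (rule sum.cong) (simp_all add: s_def g_def algebra_simps)
  also have "\<dots> =
      (\<Sum>n\<le>Suc m. (-1) ^ (Suc m - n) * of_nat (Stirling (Suc m) n) * pochhammer y n)"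
    by (subst sum.atMost_Suc_shift) simp
  finally show ?case .
qed

lemma poly_pochhammer: "poly (pochhammer q n) x = pochhammer (poly q x) n"
  by (induction n) (simp_all add: pochhammer_Suc)

lemma degree_pochhammer_X_le:
  "degree (pochhammer [:0, 1 :: 'a::{comm_ring_1, ring_no_zero_divisors}:] n) \<le> n"
proof (induction n)
  case (Suc n)
  have "degree ([:0, 1 :: 'a:] + of_nat n) \<le> 1"
    by (simp add: of_nat_poly)
  with Suc have "degree (pochhammer [:0, 1 :: 'a:] n * ([:0, 1:] + of_nat n)) \<le> n + 1"
    by (meson add_mono degree_mult_le order_trans)
  then show ?case
    by (simp add: pochhammer_Suc)
qed simp

text \<open>The expansion is lifted from values to polynomials so that coefficients can be
  compared.\<close>

lemma monom_eq_sum_Stirling_pochhammer: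
  "monom (1 :: 'a::field_char_0) m =
    (\<Sum>n\<le>m. smult ((-1) ^ (m - n) * of_nat (Stirling m n)) (pochhammer [:0, 1:] n))"
  by (rule poly_ext)
    (simp add: poly_sum poly_monom poly_pochhammer flip: power_eq_sum_Stirling_pochhammer)


section \<open>Bernoulli polynomials of higher order\<close>

lemma bernpoly_order_0: "bernpoly_order 0 n x = x ^ n"
  by (simp add: bernpoly_order_def)

text \<open>Raising the argument by 1 multiplies the generating function by
  \<open>fps_exp 1\<close>. The difference thus has a factor \<open>fps_exp 1 - 1\<close>, which
  turns one of the \<open>Suc k\<close> quotients into \<open>fps_X\<close>, an index shift.\<close>

lemma bernpoly_order_diff:
  "bernpoly_order (Suc k) (Suc n) (t + 1) - bernpoly_order (Suc k) (Suc n) t =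
    of_nat (Suc n) * bernpoly_order k n (t :: 'a::field_char_0)"
proof -
  let ?G = "fps_X / (fps_exp 1 - 1) :: 'a fps"
  have "?G ^ Suc k * fps_exp (t + 1) - ?G ^ Suc k * fps_exp t =
      (?G * (fps_exp 1 - 1)) * (?G ^ k * fps_exp t)"
    by (simp only: fps_exp_add_mult power_Suc) (simp only: algebra_simps mult_1_left)
  also have "\<dots> = fps_X * (?G ^ k * fps_exp t)"
    by (simp only: bernoulli_fps_quotient)
  finally have "fps_nth (?G ^ Suc k * fps_exp (t + 1)) (Suc n) -
      fps_nth (?G ^ Suc k * fps_exp t) (Suc n) = fps_nth (?G ^ k * fps_exp t) n"
    by (metis fps_sub_nth fps_X_mult_nth diff_Suc_1 nat.distinct(1))
  then show ?thesis
    unfolding bernpoly_order_def right_diff_distrib [symmetric] fact_Suc of_nat_mult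
    by (simp only: mult_ac of_nat_fact)
qed

text \<open>The Cauchy product behind \<open>bernpoly_order\<close>, as a formal polynomial to which
  \<open>pderiv\<close> and composition apply.\<close>

definition bern_poly :: "nat \<Rightarrow> nat \<Rightarrow> 'a::field_char_0 poly" where
  "bern_poly k n =
    (\<Sum>j\<le>n. monom (fact n * fps_nth ((fps_X / (fps_exp 1 - 1)) ^ k) j / fact (n - j)) (n - j))"

lemma poly_bern_poly: "poly (bern_poly k n) x = bernpoly_order k n x"
  unfolding bern_poly_def bernpoly_order_def fps_mult_nth
  by (simp add: poly_sum poly_monom sum_distrib_left atMost_atLeast0 mult.assoc)

lemma pderiv_sum: "pderiv (\<Sum>i\<in>A. f i) = (\<Sum>i\<in>A. pderiv (f i))"
  using higher_pderiv_sum [of 1] by simp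

lemma smult_sum_right: "smult c (\<Sum>i\<in>A. f i) = (\<Sum>i\<in>A. smult c (f i))"
  by (induction A rule: infinite_finite_induct) (simp_all add: smult_add_right)

lemma pderiv_bern_poly:
  "pderiv (bern_poly k (Suc n)) = smult (of_nat (Suc n)) (bern_poly k n :: 'a::field_char_0 poly)"
proof -
  let ?g = "fps_nth ((fps_X / (fps_exp 1 - 1)) ^ k) :: nat \<Rightarrow> 'a"
  \<comment> \<open>The summand \<open>j = Suc n\<close> is constant, so its derivative drops
    out.\<close>
  have "pderiv (bern_poly k (Suc n)) =
      (\<Sum>j\<le>n. pderiv (monom (fact (Suc n) * ?g j / fact (Suc n - j)) (Suc n - j)))"
    unfolding bern_poly_def sum.atMost_Suc pderiv_add pderiv_sum diff_self_eq_0
      pderiv_monom [of _ 0] by simp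
  also have "\<dots> = (\<Sum>j\<le>n. smult (of_nat (Suc n)) (monom (fact n * ?g j / fact (n - j)) (n - j)))"
  proof (rule sum.cong)
    fix j
    assume "j \<in> {..n}"
    then have "Suc n - j = Suc (n - j)"
      by (simp add: Suc_diff_le)
    moreover have "of_nat (Suc i) * (fact (Suc n) * c / fact (Suc i)) =
        of_nat (Suc n) * (fact n * c / fact i)" for i and c :: 'a
      by (simp add: field_simps del: of_nat_Suc)
    ultimately show "pderiv (monom (fact (Suc n) * ?g j / fact (Suc n - j)) (Suc n - j)) =
        smult (of_nat (Suc n)) (monom (fact n * ?g j / fact (n - j)) (n - j))"
      by (simp only: pderiv_monom smult_monom diff_Suc_1)
  qed simp
  finally show ?thesis
    by (simp only: bern_poly_def smult_sum_right)
qed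


section \<open>Volkenborn integrals of polynomials\<close>

context
  fixes p :: nat
  assumes padic: "padic_complex_field TYPE('a::{field_char_0, complete_space}) p"
begin

section \<open>Elementary properties of the absolute value\<close>

lemma
  fixes x y :: 'a
  shows dist_eq_pabs: "dist x y = pabs (x - y)"
    and pabs_mult: "pabs (x * y) = pabs x * pabs y"
    and pabs_add_le_max: "pabs (x + y) \<le> max (pabs x) (pabs y)"
  using padic by (auto simp: padic_complex_field_def)

lemma
  shows pabs_p: "pabs (of_nat p :: 'a) = 1 / real p"
  and p_gt_1: "p > 1"
  using padic prime_gt_1_nat by (auto simp: padic_complex_field_def)

lemma pabs_nonneg [simp]: "pabs x \<ge> 0" for x :: 'a
  by (simp add: pabs_def)

lemma pabs_eq_0_iff [simp]: "pabs x = 0 \<longleftrightarrow> x = 0" for x :: 'a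
  by (simp add: pabs_def)

lemma pabs_0 [simp]: "pabs (0 :: 'a) = 0"
  by simp

lemma pabs_1 [simp]: "pabs (1 :: 'a) = 1"
  using pabs_mult [of 1 1] pabs_eq_0_iff [of 1] by simp

lemma pabs_add_le: "pabs (x + y) \<le> pabs x + pabs y" for x y :: 'a
  using pabs_add_le_max [of x y] pabs_nonneg [of x] pabs_nonneg [of y] by linarith

lemma pabs_minus_commute: "pabs (x - y) = pabs (y - x)" for x y :: 'a
  by (metis dist_commute dist_eq_pabs)

lemma pabs_power: "pabs (x ^ n) = pabs x ^ n" for x :: 'a
  by (induction n) (simp_all add: pabs_mult)

lemma pabs_divide: "y \<noteq> 0 \<Longrightarrow> pabs (x / y) = pabs x / pabs y" for x y :: 'a
  using pabs_mult [of "x / y" y] by (simp add: field_simps)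

lemma pabs_of_nat_le_1: "pabs (of_nat n :: 'a) \<le> 1"
proof (induction n)
  case (Suc n)
  then show ?case
    using pabs_add_le_max [of 1 "of_nat n"] by simp
qed simp

section \<open>Uniform estimates for polynomials on the unit ball\<close>

lemma pabs_poly_bounded:
  obtains C where "\<And>x :: 'a. pabs x \<le> 1 \<Longrightarrow> pabs (poly P x) \<le> C"
proof -
  have "\<exists>C. \<forall>x :: 'a. pabs x \<le> 1 \<longrightarrow> pabs (poly P x) \<le> C"
  proof (induction P)
    case (pCons a P)
    then obtain C where C: "\<And>x. pabs x \<le> 1 \<Longrightarrow> pabs (poly P x) \<le> C"
      by blast
    have "pabs (poly (pCons a P) x) \<le> pabs a + C" if "pabs x \<le> 1" for x
    proof -
      have "pabs (x * poly P x) \<le> 1 * pabs (poly P x)"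
        unfolding pabs_mult by (intro mult_right_mono that) simp
      with C [OF that] pabs_add_le [of a "x * poly P x"] show ?thesis
        by simp
    qed
    then show ?case by blast
  qed auto
  then show ?thesis using that by blast
qed

lemma pabs_poly_taylor:
  obtains C where "C \<ge> 0" "\<And>x y :: 'a. pabs x \<le> 1 \<Longrightarrow> pabs y \<le> 1 \<Longrightarrow>
    pabs (poly P y - poly P x - (y - x) * poly (pderiv P) x) \<le> C * pabs (y - x) ^ 2"
proof -
  have "\<exists>C\<ge>0. \<forall>x y :: 'a. pabs x \<le> 1 \<longrightarrow> pabs y \<le> 1 \<longrightarrow>
    pabs (poly P y - poly P x - (y - x) * poly (pderiv P) x) \<le> C * pabs (y - x) ^ 2"
  proof (induction P)
    case (pCons a P)
    define R where "R x y = poly P y - poly P x - (y - x) * poly (pderiv P) x" for x y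
    obtain C where "C \<ge> 0" and
      C: "\<And>x y. pabs x \<le> 1 \<Longrightarrow> pabs y \<le> 1 \<Longrightarrow> pabs (R x y) \<le> C * pabs (y - x) ^ 2"
      using pCons.IH unfolding R_def by blast
    obtain B where B: "\<And>x. pabs x \<le> 1 \<Longrightarrow> pabs (poly (pderiv P) x) \<le> B"
      using pabs_poly_bounded by blast
    have "pabs (poly (pCons a P) y - poly (pCons a P) x - (y - x) * poly (pderiv (pCons a P)) x)
        \<le> (C + B) * pabs (y - x) ^ 2" if xy: "pabs x \<le> 1" "pabs y \<le> 1" for x y
    proof -
      \<comment> \<open>Taylor remainder of \<open>a + X * P\<close>: the old one times
        \<open>y\<close>, plus a term already quadratic in \<open>y - x\<close>. The new constant is
        therefore \<open>C + B\<close>.\<close>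
      have "poly (pCons a P) y - poly (pCons a P) x - (y - x) * poly (pderiv (pCons a P)) x =
          y * R x y + (y - x) ^ 2 * poly (pderiv P) x"
        by (simp add: pderiv_pCons R_def algebra_simps power2_eq_square)
      moreover have "pabs (y * R x y) \<le> 1 * (C * pabs (y - x) ^ 2)"
        unfolding pabs_mult by (intro mult_mono C xy) simp_all
      moreover have "pabs ((y - x) ^ 2 * poly (pderiv P) x) \<le> pabs (y - x) ^ 2 * B"
        unfolding pabs_mult pabs_power by (intro mult_left_mono B xy) simp
      ultimately show ?thesis
        using pabs_add_le [of "y * R x y" "(y - x) ^ 2 * poly (pderiv P) x"]
        by (simp add: algebra_simps)
    qed
    moreover have "0 \<le> C + B"
      using \<open>C \<ge> 0\<close> order_trans [OF pabs_nonneg B [of 0]] by simp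
    ultimately show ?case by blast
  qed auto
  then show ?thesis using that by blast
qed

text \<open>The Taylor estimate divided by \<open>y - x\<close>. The linear error yields both
  uniform differentiability and the limit defining the integral.\<close>

lemma pabs_poly_difference_quotient:
  obtains C where "C \<ge> 0" "\<And>x y :: 'a. pabs x \<le> 1 \<Longrightarrow> pabs y \<le> 1 \<Longrightarrow> x \<noteq> y \<Longrightarrow>
    dist ((poly P x - poly P y) / (x - y)) (poly (pderiv P) x) \<le> C * dist x y"
proof -
  obtain C where "C \<ge> 0" and C: "\<And>x y :: 'a. pabs x \<le> 1 \<Longrightarrow> pabs y \<le> 1 \<Longrightarrow>
      pabs (poly P y - poly P x - (y - x) * poly (pderiv P) x) \<le> C * pabs (y - x) ^ 2"
    using pabs_poly_taylor by blast
  have "dist ((poly P x - poly P y) / (x - y)) (poly (pderiv P) x) \<le> C * dist x y"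
    if xy: "pabs x \<le> 1" "pabs y \<le> 1" "x \<noteq> y" for x y
  proof -
    have pos: "pabs (y - x) > 0"
      using xy by (simp add: less_le)
    have "(poly P x - poly P y) / (x - y) - poly (pderiv P) x =
        (poly P y - poly P x - (y - x) * poly (pderiv P) x) / (y - x)"
      using xy by (simp add: divide_simps) (simp add: algebra_simps)
    then have "dist ((poly P x - poly P y) / (x - y)) (poly (pderiv P) x) =
        pabs (poly P y - poly P x - (y - x) * poly (pderiv P) x) / pabs (y - x)"
      using xy by (simp add: dist_eq_pabs pabs_divide)
    also have "\<dots> \<le> C * pabs (y - x)"
      using C [OF xy(1,2)] pos by (simp add: pos_divide_le_eq power2_eq_square mult_ac)
    finally show ?thesis
      by (simp add: dist_eq_pabs pabs_minus_commute [of x])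
  qed
  with \<open>C \<ge> 0\<close> show ?thesis using that by blast
qed

lemma uniformly_differentiable_poly:
  "uniformly_differentiable_on_Zp (poly P :: 'a \<Rightarrow> 'a)"
  unfolding uniformly_differentiable_on_Zp_def
proof (intro exI [of _ "poly (pderiv P)"] allI impI)
  fix e :: real
  assume "e > 0"
  obtain C where "C \<ge> 0" and C: "\<And>x y :: 'a. pabs x \<le> 1 \<Longrightarrow> pabs y \<le> 1 \<Longrightarrow> x \<noteq> y \<Longrightarrow>
      dist ((poly P x - poly P y) / (x - y)) (poly (pderiv P) x) \<le> C * dist x y"
    using pabs_poly_difference_quotient by blast
  \<comment> \<open>\<open>C\<close> may be 0, hence the denominator \<open>C + 1\<close>.\<close>
  have "dist ((poly P x - poly P y) / (x - y)) (poly (pderiv P) x) < e"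
    if "x \<in> Zp" "y \<in> Zp" "x \<noteq> y" "dist x y < e / (C + 1)" for x y :: 'a
  proof -
    have "C * dist x y \<le> (C + 1) * dist x y"
      by (simp add: distrib_right)
    also have "\<dots> < e"
      using that \<open>C \<ge> 0\<close> by (simp add: field_simps)
    finally show ?thesis
      using C [of x y] that by (simp add: Zp_def)
  qed
  then show "\<exists>d>0. \<forall>x\<in>Zp. \<forall>y\<in>Zp. x \<noteq> y \<and> dist x y < d \<longrightarrow>
      dist ((poly P x - poly P y) / (x - y)) (poly (pderiv P) x) < e"
    using \<open>e > 0\<close> \<open>C \<ge> 0\<close> by (intro exI [of _ "e / (C + 1)"]) auto
qed

section \<open>Integration by antidifferences\<close>

lemma has_volkenborn_integral_poly:
  fixes P Q :: "'a poly"
  assumes PQ: "\<And>t. poly Q (t + 1) - poly Q t = poly P t"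
  shows "has_volkenborn_integral p (poly P) (poly (pderiv Q) 0)"
proof -
  obtain C where C: "\<And>x y :: 'a. pabs x \<le> 1 \<Longrightarrow> pabs y \<le> 1 \<Longrightarrow> x \<noteq> y \<Longrightarrow>
      dist ((poly Q x - poly Q y) / (x - y)) (poly (pderiv Q) x) \<le> C * dist x y"
    using pabs_poly_difference_quotient by blast
  have telescope: "(\<Sum>i<n. poly P (of_nat i)) = poly Q (of_nat n) - poly Q 0" for n
    by (induction n) (simp_all add: PQ [symmetric] add.commute)
  \<comment> \<open>The telescoped mean is the difference quotient of \<open>Q\<close> between 0 and
    \<open>p ^ N\<close>, two points at distance \<open>(1 / real p) ^ N\<close>.\<close>
  have bound: "dist (1 / of_nat (p ^ N) * (\<Sum>x<p ^ N. poly P (of_nat x))) (poly (pderiv Q) 0)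
      \<le> C * (1 / real p) ^ N" for N
  proof -
    have "dist 0 (of_nat (p ^ N) :: 'a) = (1 / real p) ^ N"
      by (subst dist_commute) (simp add: dist_eq_pabs pabs_power pabs_p)
    moreover have "of_nat (p ^ N) \<noteq> (0 :: 'a)"
      using p_gt_1 by simp
    moreover have "1 / M * (poly Q M - poly Q 0) = (poly Q 0 - poly Q M) / (0 - M)" for M
      by (simp add: divide_simps)
    ultimately show ?thesis
      using C [of 0 "of_nat (p ^ N)"] pabs_of_nat_le_1 [of "p ^ N"] pabs_of_nat_le_1 [of 0]
      unfolding telescope by simp
  qed
  have "(\<lambda>N. C * (1 / real p) ^ N) \<longlonglongrightarrow> C * 0"
    using p_gt_1 by (intro tendsto_mult_left LIMSEQ_power_zero) simp
  then have "(\<lambda>N. C * (1 / real p) ^ N) \<longlonglongrightarrow> 0"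
    by simp
  then have "(\<lambda>N. dist (1 / of_nat (p ^ N) * (\<Sum>x<p ^ N. poly P (of_nat x)))
      (poly (pderiv Q) 0)) \<longlonglongrightarrow> 0"
    by (rule tendsto_sandwich [OF _ _ tendsto_const, rotated 2])
      (rule always_eventually, simp only: zero_le_dist bound simp_thms)+
  then show ?thesis
    unfolding has_volkenborn_integral_def
    using uniformly_differentiable_poly tendsto_dist_iff by blast
qed

lemma volkenborn_eqI:
  fixes f :: "'a \<Rightarrow> 'a"
  assumes "has_volkenborn_integral p f I"
  shows "volkenborn p f = I"
  unfolding volkenborn_def
proof (rule the_equality)
  show "has_volkenborn_integral p f I"
    by (fact assms)
  show "J = I" if "has_volkenborn_integral p f J" for J
    using assms that unfolding has_volkenborn_integral_def by (blast intro: LIMSEQ_unique)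
qed

text \<open>Treating a whole linear combination through one antidifference avoids a separate proof
  that the integral is linear.\<close>

lemma volkenborn_sum_bernpoly_order:
  fixes a :: "nat \<Rightarrow> 'a"
  shows "volkenborn p (\<lambda>t. \<Sum>i\<le>d. a i * bernpoly_order k i (t + c)) =
    (\<Sum>i\<le>d. a i * bernpoly_order (Suc k) i c)"
proof -
  define P where "P = (\<Sum>i\<le>d. smult (a i) (bern_poly k i \<circ>\<^sub>p [:c, 1:]))"
  \<comment> \<open>Division by \<open>Suc i\<close> cancels the factor produced by
    \<open>bernpoly_order_diff\<close>, and again the one produced by
    \<open>pderiv_bern_poly\<close>.\<close>
  define Q where
    "Q = (\<Sum>i\<le>d. smult (a i / of_nat (Suc i)) (bern_poly (Suc k) (Suc i) \<circ>\<^sub>p [:c, 1:]))"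
  have P: "poly P t = (\<Sum>i\<le>d. a i * bernpoly_order k i (t + c))" for t
    by (simp add: P_def poly_sum poly_pcompose poly_bern_poly add.commute)
  have "poly Q (t + 1) - poly Q t = poly P t" for t
  proof -
    have "poly Q (t + 1) - poly Q t = (\<Sum>i\<le>d. a i / of_nat (Suc i) *
        (bernpoly_order (Suc k) (Suc i) (t + c + 1) - bernpoly_order (Suc k) (Suc i) (t + c)))"
      by (simp add: Q_def poly_sum poly_pcompose poly_bern_poly right_diff_distrib sum_subtractf
          add_ac del: of_nat_Suc)
    then show ?thesis
      by (simp add: bernpoly_order_diff P del: of_nat_Suc)
  qed
  then have "has_volkenborn_integral p (poly P) (poly (pderiv Q) 0)"
    by (rule has_volkenborn_integral_poly)
  moreover have "poly (pderiv Q) 0 = (\<Sum>i\<le>d. a i * bernpoly_order (Suc k) i c)"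
    by (simp add: Q_def pderiv_sum pderiv_smult pderiv_pcompose pderiv_bern_poly poly_sum
        poly_pcompose poly_bern_poly pcompose_smult pderiv_pCons del: of_nat_Suc)
  moreover have "poly P = (\<lambda>t. \<Sum>i\<le>d. a i * bernpoly_order k i (t + c))"
    using P by blast
  ultimately show ?thesis
    using volkenborn_eqI by metis
qed

text \<open>The shift \<open>c\<close> is generalized because the outermost variable
  \<open>t\<close> is absorbed into it: the inner integrals are the induction hypothesis at
  \<open>t + c\<close>.\<close>

lemma volkenborn_iter_sum_power:
  fixes a :: "nat \<Rightarrow> 'a"
  shows "volkenborn_iter p k (\<lambda>xs. \<Sum>i\<le>d. a i * (sum_list xs + c) ^ i) =
    (\<Sum>i\<le>d. a i * bernpoly_order k i c)"
proof (induction k arbitrary: c)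
  case 0
  then show ?case by (simp add: bernpoly_order_0)
next
  case (Suc k)
  then show ?case
    by (simp add: add.assoc volkenborn_sum_bernpoly_order)
qed

text \<open>Coefficients above the degree vanish, so one bound \<open>d\<close> serves every
  \<open>n \<le> d\<close>; the double sum below then has a rectangular range and can be
  swapped.\<close>

lemma Daehee2_eq_sum_bernpoly_order:
  fixes x :: 'a
  assumes "n \<le> d"
  shows "Daehee2 p k n x = (\<Sum>i\<le>d. coeff (pochhammer [:0, 1:] n) i * bernpoly_order k i (- x))"
proof -
  have "degree (pochhammer [:0, 1 :: 'a:] n) \<le> d"
    using degree_pochhammer_X_le assms by (rule order_trans)
  then have "pochhammer y n = (\<Sum>i\<le>d. coeff (pochhammer [:0, 1:] n) i * y ^ i)" for y :: 'a
    using arg_cong [OF poly_as_sum_of_monoms' [of "pochhammer [:0, 1 :: 'a:] n" d],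
        of "\<lambda>q. poly q y"]
    by (simp add: poly_sum poly_monom poly_pochhammer)
  then have "(\<lambda>xs. pochhammer (sum_list xs - x) n) =
      (\<lambda>xs. \<Sum>i\<le>d. coeff (pochhammer [:0, 1:] n) i * (sum_list xs + - x) ^ i)"
    by simp
  then show ?thesis
    unfolding Daehee2_def by (simp only: volkenborn_iter_sum_power)
qed

end

theorem theorem11:
  fixes p m k :: nat and x :: "'a::{field_char_0, complete_space}"
  assumes "padic_complex_field TYPE('a) p"
    and "k \<ge> 1"
  shows "bernpoly_order k m (- x) =
    (\<Sum>n=0..m. Daehee2 p k n x * (-1) ^ (m - n) * of_nat (Stirling m n))"
proof -
  let ?s = "\<lambda>n. (-1) ^ (m - n) * of_nat (Stirling m n) :: 'a"
  let ?b = "\<lambda>i. bernpoly_order k i (- x)"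
  have "(\<Sum>n=0..m. Daehee2 p k n x * (-1) ^ (m - n) * of_nat (Stirling m n)) =
      (\<Sum>n\<le>m. \<Sum>i\<le>m. ?s n * coeff (pochhammer [:0, 1:] n) i * ?b i)"
    unfolding atMost_atLeast0 [symmetric]
    by (rule sum.cong)
      (simp_all add: Daehee2_eq_sum_bernpoly_order [OF assms(1), where d = m] sum_distrib_left
        mult_ac)
  \<comment> \<open>After the swap, the inner sum over \<open>n\<close> is the coefficient of
    \<open>X ^ i\<close> in the Stirling expansion of \<open>X ^ m\<close>, so only
    \<open>i = m\<close> survives.\<close>
  also have "\<dots> = (\<Sum>i\<le>m. coeff (monom 1 m) i * ?b i)"
    by (subst sum.swap)
      (simp add: monom_eq_sum_Stirling_pochhammer coeff_sum sum_distrib_right del: coeff_monom)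
  also have "\<dots> = ?b m"
    by (simp add: if_distrib [where f = "\<lambda>c. c * _"] cong: if_cong)
  finally show ?thesis ..
qed

end
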